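(* For every $k$, there is a polynomial-time algorithm approximating \texttt{MDD(max)} on $k$-regular input graphs within a factor of $k+1$.
   Context: \texttt{MDD(max)}: given a finite simple undirected graph $G=(V,E)$ and a distinguished vertex $p\in V$, find a set $S\subseteq V\setminus\{p\}$ of minimum cardinality such that $p$ is the unique vertex of maximum degree in the induced subgraph $G[V\setminus S]$. A graph is $k$-regular if every vertex has degree exactly $k$. *)

theory Defs
  imports
    "Graph_Theory.Digraph_Component"
    "Graph_Theory.Pair_Digraph"
    "HOL-Computational_Algebra.Polynomial"
begin

section \<open>The problem MDD(max)\<close>

text \<open>
  As in the graph library, a simple undirected graph is a finite, loop-free, symmetric digraph
  without parallel arcs. Each edge is a pair of opposite arcs, so the degree of a vertex is
  its out-degree.
\<close>

definition regular :: "nat \<Rightarrow> ('a, 'b) pre_digraph \<Rightarrow> bool" where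
  "regular k G \<longleftrightarrow> (\<forall>v \<in> verts G. out_degree G v = k)"

definition max_degree_verts :: "('a, 'b) pre_digraph \<Rightarrow> 'a set" where
  "max_degree_verts G = {v \<in> verts G. \<forall>u \<in> verts G. out_degree G u \<le> out_degree G v}"

definition mdd_max_solution :: "('a, 'b) pre_digraph \<Rightarrow> 'a \<Rightarrow> 'a set \<Rightarrow> bool" where
  "mdd_max_solution G p S \<longleftrightarrow>
     S \<subseteq> verts G - {p} \<and> max_degree_verts (induce_subgraph G (verts G - S)) = {p}"

text \<open>
  The minimum is over a finite nonempty set whenever \<open>G\<close> is finite and \<open>p\<close> is one of its
  vertices, since deleting all vertices other than \<open>p\<close> is a solution.
\<close>

definition mdd_max_opt :: "('a, 'b) pre_digraph \<Rightarrow> 'a \<Rightarrow> nat" where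
  "mdd_max_opt G p = Min (card ` {S. mdd_max_solution G p S})"


section \<open>Polynomial-time computability\<close>

text \<open>
  Deterministic Turing machines with one two-way infinite tape. States and tape symbols are
  natural numbers below \<open>tm_states\<close> and \<open>tm_symbols\<close>, the start state is 0, and the blank is 0.
  The machine halts when no transition is defined.
\<close>

datatype symbol = Zero | One | Sep

fun cell :: "symbol \<Rightarrow> nat" where
  "cell Zero = 1"
| "cell One = 2"
| "cell Sep = 3"

datatype move = MoveLeft | Stay | MoveRight

fun shift :: "move \<Rightarrow> int \<Rightarrow> int" where
  "shift MoveLeft h = h - 1"
| "shift Stay h = h"
| "shift MoveRight h = h + 1"

record tm =
  tm_states :: nat
  tm_symbols :: nat
  tm_delta :: "nat \<Rightarrow> nat \<Rightarrow> (nat \<times> nat \<times> move) option"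

definition wf_tm :: "tm \<Rightarrow> bool" where
  "wf_tm M \<longleftrightarrow>
     0 < tm_states M \<and> (\<forall>s. cell s < tm_symbols M) \<and>
     (\<forall>q < tm_states M. \<forall>a < tm_symbols M. \<forall>q' a' d.
        tm_delta M q a = Some (q', a', d) \<longrightarrow> q' < tm_states M \<and> a' < tm_symbols M)"

text \<open>A configuration consists of the state, the tape contents and the head position.\<close>

type_synonym config = "nat \<times> (int \<Rightarrow> nat) \<times> int"

fun step :: "tm \<Rightarrow> config \<Rightarrow> config" where
  "step M (q, t, h) =
     (case tm_delta M q (t h) of
        None \<Rightarrow> (q, t, h)
      | Some (q', a, d) \<Rightarrow> (q', t(h := a), shift d h))"

definition tape_of :: "symbol list \<Rightarrow> int \<Rightarrow> nat" where
  "tape_of w i = (if 0 \<le> i \<and> i < int (length w) then cell (w ! nat i) else 0)"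

definition computes_in :: "tm \<Rightarrow> symbol list \<Rightarrow> nat \<Rightarrow> symbol list \<Rightarrow> bool" where
  "computes_in M w n u \<longleftrightarrow>
     (\<exists>q t h. (step M ^^ n) (0, tape_of w, 0) = (q, t, h) \<and> tm_delta M q (t h) = None \<and>
        t = tape_of u)"

definition poly_time_computable :: "(symbol list \<Rightarrow> symbol list) \<Rightarrow> bool" where
  "poly_time_computable f \<longleftrightarrow>
     (\<exists>M. wf_tm M \<and>
       (\<exists>P :: nat poly. \<forall>w. \<exists>n \<le> poly P (length w). computes_in M w n (f w)))"


section \<open>Approximation algorithms for MDD(max)\<close>

text \<open>
  Instances have vertex set \<open>{..<n}\<close>. A set of vertices is written as its characteristic word of
  length \<open>n\<close>. An instance is written as the word of \<open>{p}\<close> followed by the rows of the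
  adjacency matrix, each preceded by a separator.
\<close>

definition mdd_instance :: "nat pair_pre_digraph \<Rightarrow> nat \<Rightarrow> bool" where
  "mdd_instance G p \<longleftrightarrow> pair_graph G \<and> (\<exists>n. pverts G = {..<n}) \<and> p \<in> pverts G"

definition encode_set :: "nat \<Rightarrow> nat set \<Rightarrow> symbol list" where
  "encode_set n A = map (\<lambda>v. if v \<in> A then One else Zero) [0..<n]"

definition encode_instance :: "nat pair_pre_digraph \<Rightarrow> nat \<Rightarrow> symbol list" where
  "encode_instance G p =
     (let n = card (pverts G) in
        encode_set n {p} @
        concat (map (\<lambda>u. Sep # encode_set n {v. (u, v) \<in> parcs G}) [0..<n]))"

text \<open>
  On every instance whose graph satisfies \<open>C\<close>, the output of \<open>f\<close> encodes a solution with at most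
  \<open>r\<close> times the minimum cardinality. On other words \<open>f\<close> is unconstrained.
\<close>

definition mdd_max_approximation ::
  "real \<Rightarrow> (nat pair_pre_digraph \<Rightarrow> bool) \<Rightarrow> (symbol list \<Rightarrow> symbol list) \<Rightarrow> bool" where
  "mdd_max_approximation r C f \<longleftrightarrow>
     (\<forall>G p. mdd_instance G p \<and> C G \<longrightarrow>
       (\<exists>S. f (encode_instance G p) = encode_set (card (pverts G)) S \<and>
          mdd_max_solution (with_proj G) p S \<and>
          real (card S) \<le> r * real (mdd_max_opt (with_proj G) p)))"

end

theory Submission
  imports Defs
begin

text \<open>
  Every solution \<open>S\<close> of a \<open>k\<close>-regular instance dominates all vertices other than \<open>p\<close>: a surviving
  vertex ends with smaller degree than \<open>p\<close>, hence smaller than \<open>k\<close>, and so has lost a neighbour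
  to \<open>S\<close>. As a vertex dominates at most \<open>k + 1\<close> vertices, \<open>n - 1 \<le> (k + 1) |S|\<close>. Deleting
  everything except \<open>p\<close> is therefore already within the factor \<open>k + 1\<close>, and its
  encoding is the complement of the first word of the input.
\<close>

text \<open>Only \<open>p\<close> survives, so it has no competitor. This serves twice: as the
  output of the algorithm, and to show that the minimum in \<open>mdd_max_opt\<close> ranges over a
  nonempty set.\<close>

lemma mdd_max_solution_all:
  assumes "p \<in> verts G"
  shows "mdd_max_solution G p (verts G - {p})"
proof -
  have "verts G - (verts G - {p}) = {p}" using assms by auto
  then show ?thesis by (auto simp: mdd_max_solution_def max_degree_verts_def)
qed

lemma (in graph) mdd_max_solution_dominates:
  assumes "regular k G" "mdd_max_solution G p S" "v \<in> verts G" "v \<noteq> p" "v \<notin> S"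
  shows "\<exists>s \<in> S. s \<rightarrow> v"
proof (rule ccontr)
  assume no: "\<not> ?thesis"
  define H where "H = induce_subgraph G (verts G - S)"
  have max: "max_degree_verts H = {p}"
    using assms(2) by (simp add: mdd_max_solution_def H_def)
  have vertsH: "verts H = verts G - S" by (simp add: H_def)
  have outH: "out_arcs H u \<subseteq> out_arcs G u" for u
    by (auto simp: H_def out_arcs_def)
  \<comment> \<open>With no neighbour in \<open>S\<close>, \<open>v\<close> keeps all its
    \<open>k\<close> arcs. Deletion never raises a degree, so \<open>v\<close> attains the maximum
    in \<open>H\<close> and competes with \<open>p\<close>.\<close>
  have "out_arcs G v \<subseteq> out_arcs H v"
  proof
    fix e assume e: "e \<in> out_arcs G v"
    then have "v \<rightarrow> head G e" by (auto intro: in_arcs_imp_in_arcs_ends)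
    then have "head G e \<rightarrow> v" by (rule graph_symmetric)
    then have "head G e \<notin> S" using no by blast
    then show "e \<in> out_arcs H v"
      using e assms(3,5) by (auto simp: H_def out_arcs_def)
  qed
  then have degv: "out_degree H v = k"
    using outH[of v] assms(1,3) by (auto simp: out_degree_def regular_def)
  have "out_degree H u \<le> k" if "u \<in> verts H" for u
    using card_mono[OF finite_out_arcs outH[of u]] assms(1) that
    by (auto simp: out_degree_def regular_def vertsH)
  then have "v \<in> max_degree_verts H"
    using degv assms(3,5) by (auto simp: max_degree_verts_def vertsH)
  then show False using max assms(4) by auto
qed

lemma (in graph) card_verts_le_mdd_max_solution:
  assumes "regular k G" "mdd_max_solution G p S"
  shows "card (verts G - {p}) \<le> (k + 1) * card S"
proof -
  have SV: "S \<subseteq> verts G" using assms(2) by (auto simp: mdd_max_solution_def)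
  then have fin: "finite S" by (rule finite_subset) simp
  \<comment> \<open>\<open>B s\<close> is the closed neighbourhood of \<open>s\<close>; by
    regularity it has at most \<open>k + 1\<close> elements.\<close>
  define B where "B s = insert s (head G ` out_arcs G s)" for s
  have "verts G - {p} \<subseteq> (\<Union>s\<in>S. B s)"
  proof
    fix v assume v: "v \<in> verts G - {p}"
    show "v \<in> (\<Union>s\<in>S. B s)"
    proof (cases "v \<in> S")
      case False
      then obtain s where "s \<in> S" "s \<rightarrow> v"
        using mdd_max_solution_dominates[OF assms] v by blast
      moreover from this obtain e where "e \<in> out_arcs G s" "head G e = v"
        by (auto simp: arcs_ends_def arc_to_ends_def)
      ultimately show ?thesis unfolding B_def by blast
    qed (auto simp: B_def)
  qed
  then have "card (verts G - {p}) \<le> card (\<Union>s\<in>S. B s)"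
    using fin by (intro card_mono) (auto simp: B_def)
  also have "\<dots> \<le> (\<Sum>s\<in>S. card (B s))" by (rule card_UN_le[OF fin])
  also have "\<dots> \<le> (\<Sum>s\<in>S. k + 1)"
  proof (rule sum_mono)
    fix s assume "s \<in> S"
    then have "card (out_arcs G s) = k"
      using SV assms(1) by (auto simp: regular_def out_degree_def)
    then have "card (head G ` out_arcs G s) \<le> k"
      using card_image_le[OF finite_out_arcs, of "head G" s] by simp
    then show "card (B s) \<le> k + 1"
      using card_insert_le_m1[of "k + 1"] by (simp add: B_def)
  qed
  finally show ?thesis by (simp add: mult.commute)
qed

text \<open>\<open>Min\<close> is attained because the solutions form a finite, nonempty family of
  subsets of \<open>verts G\<close>.\<close>

lemma (in fin_digraph) mdd_max_opt_attained:
  assumes "p \<in> verts G"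
  obtains S where "mdd_max_solution G p S" "card S = mdd_max_opt G p"
proof -
  have "{S. mdd_max_solution G p S} \<subseteq> Pow (verts G)"
    by (auto simp: mdd_max_solution_def)
  then have "finite {S. mdd_max_solution G p S}"
    by (rule finite_subset) simp
  then have "mdd_max_opt G p \<in> card ` {S. mdd_max_solution G p S}"
    unfolding mdd_max_opt_def using mdd_max_solution_all[OF assms] by (intro Min_in) auto
  then show thesis using that by auto
qed

lemma (in graph) card_verts_le_mdd_max_opt:
  assumes "regular k G" "p \<in> verts G"
  shows "card (verts G - {p}) \<le> (k + 1) * mdd_max_opt G p"
  using mdd_max_opt_attained[OF assms(2)] card_verts_le_mdd_max_solution[OF assms(1)] by metis


fun flip :: "symbol \<Rightarrow> symbol" where
  "flip Zero = One"
| "flip One = Zero"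
| "flip Sep = Sep"

text \<open>Total on words, since \<open>poly_time_computable\<close> requires a halting run on
  malformed inputs as well.\<close>

definition complement_word :: "symbol list \<Rightarrow> symbol list" where
  "complement_word w = map flip (takeWhile (\<lambda>s. s \<noteq> Sep) w)"

text \<open>The word of \<open>{p}\<close> has no separator and every row starts with one, so
  \<open>takeWhile\<close> cuts exactly between them. The infinite set \<open>- {p}\<close> is
  harmless: \<open>encode_set\<close> looks only below its length.\<close>

lemma complement_word_encode_instance:
  "complement_word (encode_instance G p) = encode_set (card (pverts G)) (- {p})"
proof -
  define n where "n = card (pverts G)"
  define rows where
    "rows = concat (map (\<lambda>u. Sep # encode_set n {v. (u, v) \<in> parcs G}) [0..<n])"
  have "takeWhile (\<lambda>s. s \<noteq> Sep) rows = []"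
    unfolding rows_def by (cases "[0..<n]") auto
  then have "takeWhile (\<lambda>s. s \<noteq> Sep) (encode_set n {p} @ rows) = encode_set n {p}"
    by (subst takeWhile_append2) (auto simp: encode_set_def)
  then show ?thesis
    by (simp add: complement_word_def encode_instance_def Let_def flip: n_def rows_def)
      (simp add: encode_set_def)
qed

text \<open>State 0 complements the first word, state 1 erases the rest.\<close>

definition complement_tm :: tm where
  "complement_tm = \<lparr>tm_states = 2, tm_symbols = 4,
     tm_delta = (\<lambda>q a.
       if a = 0 then None
       else if q = 0 \<and> a = 1 then Some (0, 2, MoveRight)
       else if q = 0 \<and> a = 2 then Some (0, 1, MoveRight)
       else Some (1, 0, MoveRight))\<rparr>"

lemma wf_complement_tm: "wf_tm complement_tm"
proof -
  have "cell s < 4" for s by (cases s) auto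
  then show ?thesis by (auto simp: wf_tm_def complement_tm_def split: if_splits)
qed

lemma tape_of_snoc: "tape_of (u @ [s]) = (tape_of u)(int (length u) := cell s)"
  by (auto simp: fun_eq_iff tape_of_def nth_append nat_less_iff)

lemma complement_word_no_Sep: "Sep \<notin> set v \<Longrightarrow> complement_word v = map flip v"
  unfolding complement_word_def by (rule arg_cong[where f = "map flip"]) auto

lemma complement_word_snoc:
  "complement_word (v @ [s]) =
     (if Sep \<in> set v \<or> s = Sep then complement_word v else complement_word v @ [flip s])"
proof (cases "Sep \<in> set v")
  case True
  then show ?thesis by (simp add: complement_word_def)
next
  case False
  show ?thesis
  proof (cases "s = Sep")
    case True
    then show ?thesis by (simp add: complement_word_def takeWhile_tail)
  next
    case s: False
    with False have "Sep \<notin> set (v @ [s])" by auto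
    from complement_word_no_Sep[OF this] complement_word_no_Sep[OF False] False s
    show ?thesis by simp
  qed
qed

lemma length_complement_word:
  "length (complement_word v) \<le> length v" "Sep \<notin> set v \<Longrightarrow> length (complement_word v) = length v"
  by (simp add: complement_word_def length_takeWhile_le, simp add: complement_word_no_Sep)

text \<open>Invariant of a single left-to-right pass: the tape is final to the left of the head and
  untouched from the head on. The unread \<open>w\<close> is generalised because each step moves one
  letter from it to \<open>v\<close>.\<close>

lemma complement_tm_steps:
  "(step complement_tm ^^ length v) (0, tape_of (v @ w), 0) =
     (if Sep \<in> set v then 1 else 0,
      (\<lambda>i. if i < int (length v) then tape_of (complement_word v) i else tape_of (v @ w) i),
      int (length v))"
proof (induction v arbitrary: w rule: rev_induct)
  case Nil
  then show ?case by (auto simp: tape_of_def)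
next
  case (snoc s v)
  have head: "tape_of (v @ s # w) (int (length v)) = cell s"
    by (simp add: tape_of_def)
  have beyond: "tape_of (complement_word v) (int (length v)) = 0"
    using length_complement_word(1)[of v] by (simp add: tape_of_def)
  let ?q = "\<lambda>v. if Sep \<in> set v then 1 else 0 :: nat"
  let ?t = "\<lambda>v w i. if i < int (length v) then tape_of (complement_word v) i
    else tape_of (v @ w) i"
  \<comment> \<open>The symbol written: blank from the first separator on. This agrees with the
    output tape, which by \<open>beyond\<close> is blank there; before a separator, the output ends
    exactly at the head.\<close>
  let ?a = "if Sep \<in> set v \<or> s = Sep then 0 else cell (flip s)"
  have step: "step complement_tm (?q v, t, h) = (?q (v @ [s]), t(h := ?a), h + 1)"
    if "t h = cell s" for t h
    using that by (cases s) (simp_all add: complement_tm_def)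
  have tape: "(?t v (s # w))(int (length v) := ?a) = ?t (v @ [s]) w"
  proof
    fix i
    consider "i < int (length v)" | "i = int (length v)" | "i > int (length v)" by linarith
    then show "((?t v (s # w))(int (length v) := ?a)) i = ?t (v @ [s]) w i"
      by cases (use beyond length_complement_word(2)[of v] in
        \<open>auto simp: complement_word_snoc tape_of_snoc\<close>)
  qed
  have "(step complement_tm ^^ length (v @ [s])) (0, tape_of ((v @ [s]) @ w), 0) =
      step complement_tm (?q v, ?t v (s # w), int (length v))"
    using snoc.IH[of "s # w"] by simp
  also have "\<dots> = (?q (v @ [s]), (?t v (s # w))(int (length v) := ?a), int (length v) + 1)"
    by (rule step) (use head in simp)
  also have "\<dots> = (?q (v @ [s]), ?t (v @ [s]) w, int (length (v @ [s])))"
    unfolding tape by simp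
  finally show ?case .
qed

lemma computes_complement_word:
  "computes_in complement_tm w (length w) (complement_word w)"
proof -
  have "tape_of w i = tape_of (complement_word w) i" if "\<not> i < int (length w)" for i
    using that length_complement_word(1)[of w] by (simp add: tape_of_def)
  then have "(\<lambda>i. if i < int (length w) then tape_of (complement_word w) i else tape_of w i) =
      tape_of (complement_word w)"
    by (auto simp: fun_eq_iff)
  then have "(step complement_tm ^^ length w) (0, tape_of w, 0) =
      (if Sep \<in> set w then 1 else 0, tape_of (complement_word w), int (length w))"
    using complement_tm_steps[of w "[]"] unfolding append_Nil2 by simp
  \<comment> \<open>The head stands just after the input, on a blank, where both states
    halt.\<close>
  moreover have "tape_of (complement_word w) (int (length w)) = 0"
    using length_complement_word(1)[of w] by (simp add: tape_of_def)
  ultimately show ?thesis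
    by (simp add: computes_in_def) (simp add: complement_tm_def)
qed

lemma poly_time_complement_word: "poly_time_computable complement_word"
  unfolding poly_time_computable_def
proof (intro exI conjI allI)
  show "wf_tm complement_tm" by (rule wf_complement_tm)
  show "length w \<le> poly [:0, 1:] (length w)" for w :: "symbol list" by simp
  show "computes_in complement_tm w (length w) (complement_word w)" for w
    by (rule computes_complement_word)
qed

theorem theorem10:
  fixes k :: nat
  shows "\<exists>f. poly_time_computable f \<and>
    mdd_max_approximation (real (k + 1)) (\<lambda>G. regular k (with_proj G)) f"
proof (intro exI conjI)
  show "poly_time_computable complement_word" by (rule poly_time_complement_word)
  show "mdd_max_approximation (real (k + 1)) (\<lambda>G. regular k (with_proj G)) complement_word"
    unfolding mdd_max_approximation_def
  proof (intro allI impI, elim conjE)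
    fix G p assume inst: "mdd_instance G p" and reg: "regular k (with_proj G)"
    from inst interpret pair_graph G by (simp add: mdd_instance_def)
    from inst obtain n where n: "pverts G = {..<n}" and p: "p \<in> pverts G"
      by (auto simp: mdd_instance_def)
    let ?S = "pverts G - {p}"
    \<comment> \<open>Below \<open>n\<close> the sets \<open>- {p}\<close> and \<open>?S\<close>
      agree, so their characteristic words coincide.\<close>
    have "complement_word (encode_instance G p) = encode_set (card (pverts G)) ?S"
      by (auto simp: complement_word_encode_instance encode_set_def n)
    moreover have "mdd_max_solution (with_proj G) p ?S"
      using mdd_max_solution_all[of p "with_proj G"] p by simp
    moreover have "card ?S \<le> (k + 1) * mdd_max_opt (with_proj G) p"
      using card_verts_le_mdd_max_opt[OF reg, of p] p by simp
    then have "real (card ?S) \<le> real (k + 1) * real (mdd_max_opt (with_proj G) p)"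
      by (metis of_nat_le_iff of_nat_mult)
    ultimately show "\<exists>S. complement_word (encode_instance G p) = encode_set (card (pverts G)) S \<and>
        mdd_max_solution (with_proj G) p S \<and>
        real (card S) \<le> real (k + 1) * real (mdd_max_opt (with_proj G) p)"
      by blast
  qed
qed

end
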